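(* Let $N\ge2$, $m\in\mathbb{N}$, $m\ge1$, $p\in\mathbb{R}$, $\gamma>0$, and consider the system of phase oscillators with inertia $$\ddot{\bm\phi}+\gamma\dot{\bm\phi}=p\,\bm 1+F(\bm\phi),$$ where $F=(f_1,\dots,f_N)^T$ is phase-shift invariant and every $\bm\vartheta\in SM_m$ gives an $m$-splay state $\bm\phi(t)=\Omega t\,\bm 1+\bm\vartheta$ of the system. Let $\bm\vartheta\in SM_m$ and let $L=L(\bm\vartheta)$ be the matrix with $l_{ij}=\frac{\partial f_i}{\partial\phi_j}(\bm\vartheta)$ for $i\ne j$ and $l_{ii}=-\sum_{j\neq i}\frac{\partial f_i}{\partial\phi_j}(\bm\vartheta)$. Then the $m$-splay state given by $\bm\vartheta$ is linearly stable if and only if $\mathrm{Re}(\mu_k)<0$ for $k=1,2,3,4$, where $\mu_1,\dots,\mu_4$ are the four numbers $$\mu=-\frac{\gamma}{2}\pm\sqrt{\left(\frac{\gamma}{2}\right)^2+\lambda_i},\quad i=1,2,\qquad \lambda_{1,2}=\frac{\mathrm{Tr}(L)}{2}\pm\frac12\sqrt{2\,\mathrm{Tr}(L^2)-\mathrm{Tr}(L)^2}.$$ Moreover, $\lambda_{1},\lambda_2$ are the two eigenvalues of $L$ that remain (counted with algebraic multiplicity) after removing $N-2$ zero eigenvalues. (Square roots of complex numbers denote either of the two complex square roots.)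
   Context: Phases $\phi_i$ are taken modulo $2\pi$, $\bm 1=(1,\dots,1)^T$, and $F:\mathbb{R}^N\to\mathbb{R}^N$ is continuously differentiable and $2\pi$-periodic in each argument. Order parameter: $R_m(\bm\phi)=\left|\frac1N\sum_{j=1}^N e^{\mathrm{i}m\phi_j}\right|$. The $m$-splay manifold is $SM_m=\{\bm\vartheta\in[0,2\pi)^N:R_m(\bm\vartheta)=0\}$. An $m$-splay state is a solution of the form $\phi_i(t)=\Omega t+\vartheta_i$ with $R_m(\bm\vartheta)=0$. Standing hypotheses: (1) there is $\Omega\in\mathbb{R}$ such that for all $\bm\vartheta\in SM_m$, $\bm\phi(t)=\Omega t\,\bm 1+\bm\vartheta$ is a solution of the system (equivalently $p+f_i(\bm\vartheta)=\gamma\Omega$ for all $i$); (2) $F(\bm\phi+\psi\bm 1)=F(\bm\phi)$ for all $\psi\in\mathbb{R}$ and all $\bm\phi$. Linear stability: writing the system in first-order form with $\bm\psi=\dot{\bm\phi}$, the variational equation around the splay state is governed by the $2N\times2N$ Jacobian $$J=\begin{pmatrix}0&\mathbb{I}_N\\ L&-\gamma\mathbb{I}_N\end{pmatrix}.$$ $J$ has the eigenvalue $0$ with algebraic multiplicity at least $N-2$ (neutral directions along the family of splay states). The splay state is called linearly stable if all remaining $N+2$ eigenvalues of $J$ (the eigenvalues counted with algebraic multiplicity, after removing $N-2$ zeros) have strictly negative real part. *)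

theory Defs
  imports
    "HOL-Analysis.Analysis"
    "HOL-Computational_Algebra.Computational_Algebra"
begin

definition order_parameter :: "nat \<Rightarrow> real ^ 'n \<Rightarrow> real" where
  "order_parameter m \<phi> =
     norm ((\<Sum>j\<in>UNIV. exp (\<i> * of_nat m * of_real (\<phi> $ j))) / of_nat CARD('n))"

definition splay_manifold :: "nat \<Rightarrow> (real ^ 'n) set" where
  "splay_manifold m =
     {\<theta>. (\<forall>j. 0 \<le> \<theta> $ j \<and> \<theta> $ j < 2 * pi) \<and> order_parameter m \<theta> = 0}"

definition continuously_differentiable ::
    "('a::real_normed_vector \<Rightarrow> 'b::real_normed_vector) \<Rightarrow> bool" where
  "continuously_differentiable F \<longleftrightarrow>
     (\<exists>F' :: 'a \<Rightarrow> ('a \<Rightarrow>\<^sub>L 'b).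
        (\<forall>x. (F has_derivative blinfun_apply (F' x)) (at x)) \<and> continuous_on UNIV F')"

definition periodic_in_each_argument :: "(real ^ 'n \<Rightarrow> real ^ 'n) \<Rightarrow> bool" where
  "periodic_in_each_argument F \<longleftrightarrow> (\<forall>\<phi> j. F (\<phi> + (2 * pi) *\<^sub>R axis j 1) = F \<phi>)"

(* The constant 1 of type real ^ 'n is the all-ones vector. *)
definition phase_shift_invariant :: "(real ^ 'n \<Rightarrow> real ^ 'n) \<Rightarrow> bool" where
  "phase_shift_invariant F \<longleftrightarrow> (\<forall>\<phi> \<psi>. F (\<phi> + \<psi> *\<^sub>R 1) = F \<phi>)"

definition oscillator_solution ::
    "real \<Rightarrow> real \<Rightarrow> (real ^ 'n \<Rightarrow> real ^ 'n) \<Rightarrow> (real \<Rightarrow> real ^ 'n) \<Rightarrow> bool" where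
  "oscillator_solution \<gamma> p F \<phi> \<longleftrightarrow>
     (\<exists>\<phi>' \<phi>''. \<forall>t.
        (\<phi> has_vector_derivative \<phi>' t) (at t) \<and>
        (\<phi>' has_vector_derivative \<phi>'' t) (at t) \<and>
        \<phi>'' t + \<gamma> *\<^sub>R \<phi>' t = p *\<^sub>R 1 + F (\<phi> t))"

definition splay_state ::
    "nat \<Rightarrow> real \<Rightarrow> real \<Rightarrow> (real ^ 'n \<Rightarrow> real ^ 'n) \<Rightarrow> real \<Rightarrow> real ^ 'n \<Rightarrow> bool" where
  "splay_state m \<gamma> p F \<Omega> \<theta> \<longleftrightarrow>
     order_parameter m \<theta> = 0 \<and>
     oscillator_solution \<gamma> p F (\<lambda>t. (\<Omega> * t) *\<^sub>R 1 + \<theta>)"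

definition partial_deriv ::
    "(real ^ 'n \<Rightarrow> real ^ 'n) \<Rightarrow> 'n \<Rightarrow> 'n \<Rightarrow> real ^ 'n \<Rightarrow> real" where
  "partial_deriv F i j \<theta> = deriv (\<lambda>x. F (\<chi> k. if k = j then x else \<theta> $ k) $ i) (\<theta> $ j)"

definition splay_L :: "(real ^ 'n \<Rightarrow> real ^ 'n) \<Rightarrow> real ^ 'n \<Rightarrow> real ^ 'n ^ 'n" where
  "splay_L F \<theta> =
     (\<chi> i j. if i = j then - (\<Sum>k\<in>UNIV - {i}. partial_deriv F i k \<theta>)
            else partial_deriv F i j \<theta>)"

(* The block matrix ((0, I), (L, -\<gamma> I)); Inl indexes the coordinates of the phases,
   Inr those of the velocities. *)
definition inertia_jacobian :: "real \<Rightarrow> real ^ 'n ^ 'n \<Rightarrow> real ^ ('n + 'n) ^ ('n + 'n)" where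
  "inertia_jacobian \<gamma> L =
     (\<chi> r c. case r of
        Inl i \<Rightarrow> (case c of Inl j \<Rightarrow> 0 | Inr j \<Rightarrow> (mat 1 :: real ^ 'n ^ 'n) $ i $ j)
      | Inr i \<Rightarrow> (case c of Inl j \<Rightarrow> L $ i $ j
                          | Inr j \<Rightarrow> - \<gamma> * (mat 1 :: real ^ 'n ^ 'n) $ i $ j))"

definition charpoly :: "'a::comm_ring_1 ^ 'n ^ 'n \<Rightarrow> 'a poly" where
  "charpoly A = det (mat [:0, 1:] - map_matrix (\<lambda>a. [:a:]) A)"

(* Complex eigenvalues of a real matrix, each as often as its algebraic multiplicity. *)
definition eigenvalues :: "real ^ 'n ^ 'n \<Rightarrow> complex multiset" where
  "eigenvalues A = proots (charpoly (map_matrix complex_of_real A))"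

(* M is the multiset of the N + 2 eigenvalues that remain after removing N - 2 zeros.
   Writing the spectrum as a sum avoids the truncated difference of multisets. *)
definition linearly_stable :: "real \<Rightarrow> (real ^ 'n \<Rightarrow> real ^ 'n) \<Rightarrow> real ^ 'n \<Rightarrow> bool" where
  "linearly_stable \<gamma> F \<theta> \<longleftrightarrow>
     (\<exists>M. eigenvalues (inertia_jacobian \<gamma> (splay_L F \<theta>)) = replicate_mset (CARD('n) - 2) 0 + M \<and>
          (\<forall>\<mu>\<in>#M. Re \<mu> < 0))"

end

theory Submission
  imports Defs
begin

text \<open>
  The map \<open>F\<close> is constant on the zero set of the order parameter. At a regular point, i.e. one
  with two phases \<open>b\<close>, \<open>c\<close> such that \<open>sin (m (\<theta>\<^sub>b - \<theta>\<^sub>c)) \<noteq> 0\<close>, replacing the coordinates \<open>b\<close>, \<open>c\<close>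
  by the real and imaginary part of the order parameter is a local diffeomorphism, and the
  remaining \<open>N - 2\<close> coordinate directions lie in the kernel of \<open>DF = L\<close>. After a change of basis
  \<open>L\<close> therefore has \<open>N - 2\<close> zero columns, whence
  \<open>det (x - L) = x\<^sup>N\<^sup>-\<^sup>2 (x\<^sup>2 - tr L x + ((tr L)\<^sup>2 - tr L\<^sup>2) / 2)\<close>. At a singular point with \<open>N \<ge> 3\<close>, rotating
  a pair of antipodal oscillators gives regular points converging to it, and the identity passes
  to the limit. Finally \<open>det (x - J) = det (x (x + \<gamma>) - L)\<close>, so the spectrum of \<open>J\<close> consists of
  the solutions of \<open>\<mu> (\<mu> + \<gamma>) = \<lambda>\<close> with \<open>\<lambda>\<close> in the spectrum of \<open>L\<close>: besides \<open>N - 2\<close> zeros these are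
  \<open>N - 2\<close> times \<open>- \<gamma> < 0\<close> and \<open>\<mu>\<^sub>1, \<dots>, \<mu>\<^sub>4\<close>.
\<close>

no_notation fps_nth (infixl "$" 75)

section \<open>Determinants and characteristic polynomials\<close>

text \<open>In the Leibniz expansion, an index outside \<open>{b, c}\<close> contributes
  \<open>x\<close> if the permutation fixes it and 0 otherwise. Only the identity and the
  transposition of \<open>b\<close> and \<open>c\<close> survive, and they give the 2 by 2
  determinant.\<close>

lemma det_mat_minus_two_columns:
  fixes M :: "'a::comm_ring_1 ^ 'n ^ 'n"
  assumes "b \<noteq> c" and zero: "\<And>i j. j \<notin> {b, c} \<Longrightarrow> M $ i $ j = 0"
  shows "det (mat x - M) =
    x ^ (CARD('n) - 2) * ((x - M $ b $ b) * (x - M $ c $ c) - M $ b $ c * M $ c $ b)"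
proof -
  \<comment> \<open>The Leibniz sum picks one entry from each row, so the zero columns of
    \<open>M\<close> are turned into rows first.\<close>
  define T where "T = transpose (mat x - M)"
  have T: "T $ i $ j = (if i = j then x else 0) - M $ j $ i" for i j
    by (auto simp: T_def transpose_def mat_def)
  let ?f = "\<lambda>p. of_int (sign p) * (\<Prod>i\<in>UNIV. T $ i $ p i)"
  have rest: "(\<Prod>i\<in>UNIV. T $ i $ p i) = x ^ (CARD('n) - 2) * (T $ b $ p b * T $ c $ p c)"
    if "\<And>j. j \<notin> {b, c} \<Longrightarrow> p j = j" for p
  proof -
    have "(\<Prod>i\<in>UNIV. T $ i $ p i) = (\<Prod>i\<in>UNIV - {b, c}. T $ i $ p i) * (\<Prod>i\<in>{b, c}. T $ i $ p i)"
      by (rule prod.subset_diff) auto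
    also have "(\<Prod>i\<in>UNIV - {b, c}. T $ i $ p i) = (\<Prod>i\<in>UNIV - {b, c}. x)"
      by (rule prod.cong) (use that in \<open>auto simp: T zero\<close>)
    finally show ?thesis using \<open>b \<noteq> c\<close> by (simp add: card_Diff_subset numeral_2_eq_2)
  qed
  have "det (mat x - M) = det T" by (simp add: T_def)
  also have "\<dots> = sum ?f {p. p permutes UNIV}" by (simp add: det_def)
  also have "\<dots> = sum ?f {id, Transposition.transpose b c}"
  proof (rule sum.mono_neutral_right)
    show "\<forall>p\<in>{p. p permutes UNIV} - {id, Transposition.transpose b c}. ?f p = 0"
    proof
      fix p assume p: "p \<in> {p. p permutes UNIV} - {id, Transposition.transpose b c}"
      have "\<exists>j. j \<notin> {b, c} \<and> p j \<noteq> j"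
      proof (rule ccontr)
        assume "\<not> ?thesis"
        hence "p permutes {b, c}" using p permutes_superset[of p UNIV "{b, c}"] by blast
        thus False using p by (simp add: permutes_doubleton_iff)
      qed
      then obtain j where "j \<notin> {b, c}" "p j \<noteq> j" by blast
      hence "T $ j $ p j = 0" by (simp add: T zero)
      hence "(\<Prod>i\<in>UNIV. T $ i $ p i) = 0" by (intro prod_zero) auto
      thus "?f p = 0" by simp
    qed
  qed (auto simp: finite_permutations permutes_id permutes_swap_id)
  also have "\<dots> = x ^ (CARD('n) - 2) * (T $ b $ b * T $ c $ c) - x ^ (CARD('n) - 2) * (T $ b $ c * T $ c $ b)"
  proof -
    have "id \<noteq> Transposition.transpose b c"
      using \<open>b \<noteq> c\<close> by (metis id_apply transpose_apply_first)
    moreover have "(\<Prod>i\<in>UNIV. T $ i $ Transposition.transpose b c i) =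
        x ^ (CARD('n) - 2) * (T $ b $ c * T $ c $ b)"
      by (subst rest) (auto simp: transpose_eq_iff)
    ultimately show ?thesis
      using \<open>b \<noteq> c\<close> by (simp add: rest sign_swap_id)
  qed
  finally show ?thesis using \<open>b \<noteq> c\<close> by (simp add: T algebra_simps)
qed

text \<open>Conjugation by \<open>P\<close> keeps \<open>trace L\<close>,
  \<open>trace (L ** L)\<close> and the determinant, and leaves only two nonzero columns. The 2 by 2
  determinant is rewritten through traces by Newton's identity, so that the formula mentions neither
  \<open>P\<close> nor \<open>b\<close> and \<open>c\<close> and can survive a limit in which these
  are lost.\<close>

lemma det_mat_minus_rank_two:
  fixes L P :: "real ^ 'n ^ 'n"
  assumes "b \<noteq> c" "invertible P" and zero: "\<And>i j. j \<notin> {b, c} \<Longrightarrow> (L ** P) $ i $ j = 0"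
  shows "det (mat x - L) =
    x ^ (CARD('n) - 2) * (x\<^sup>2 - trace L * x + ((trace L)\<^sup>2 - trace (L ** L)) / 2)"
proof -
  obtain Q where PQ: "P ** Q = mat 1" "Q ** P = mat 1"
    using \<open>invertible P\<close> by (auto simp: invertible_def)
  define M where "M = Q ** (L ** P)"
  have M0: "M $ i $ j = 0" if "j \<notin> {b, c}" for i j
    using that by (simp add: M_def matrix_matrix_mult_def[of Q] zero)
  have sum2: "(\<Sum>i\<in>UNIV. f i) = f b + f c" if "\<And>i. i \<notin> {b, c} \<Longrightarrow> f i = 0" for f :: "'n \<Rightarrow> real"
  proof -
    have "(\<Sum>i\<in>UNIV. f i) = (\<Sum>i\<in>{b, c}. f i)"
      by (rule sum.mono_neutral_right) (use that in auto)
    thus ?thesis using \<open>b \<noteq> c\<close> by simp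
  qed
  have LM: "trace L = trace M"
    unfolding M_def by (subst trace_mul_sym) (simp add: matrix_mul_assoc[symmetric] PQ)
  have "M ** M = Q ** (L ** (P ** Q) ** (L ** P))"
    unfolding M_def by (simp only: matrix_mul_assoc)
  hence LLM: "trace (L ** L) = trace (M ** M)"
    by (simp add: PQ trace_mul_sym[of Q] matrix_mul_assoc[symmetric])
  have trM: "trace M = M $ b $ b + M $ c $ c"
    unfolding trace_def by (rule sum2) (simp add: M0)
  have "trace (M ** M) = (\<Sum>i\<in>UNIV. M $ i $ b * M $ b $ i + M $ i $ c * M $ c $ i)"
    unfolding trace_def matrix_matrix_mult_def
    by (rule sum.cong[OF refl], simp, rule sum2, simp add: M0)
  also have "\<dots> = (M $ b $ b * M $ b $ b + M $ b $ c * M $ c $ b) + (M $ c $ b * M $ b $ c + M $ c $ c * M $ c $ c)"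
    by (rule sum2) (simp add: M0)
  finally have trMM: "trace (M ** M) = \<dots>" .
  have "Q ** ((mat x - L) ** P) = mat x - M"
  proof -
    have "mat x ** P = x *\<^sub>R P" "Q ** (x *\<^sub>R P) = x *\<^sub>R (Q ** P)" 
      by (auto simp: vec_eq_iff matrix_matrix_mult_def mat_def if_distrib[of "\<lambda>u. u * _"]
          sum_distrib_left mult.left_commute cong: if_cong)
    moreover have "x *\<^sub>R mat 1 = (mat x :: real^'n^'n)" by (simp add: vec_eq_iff mat_def)
    moreover have "(mat x - L) ** P = mat x ** P - L ** P" "Q ** (A - B) = Q ** A - Q ** B" for A B :: "real ^ 'n ^ 'n"
      by (simp_all add: vec_eq_iff matrix_matrix_mult_def algebra_simps sum_subtractf)
    ultimately show ?thesis by (simp add: M_def PQ)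
  qed
  hence "det (mat x - M) = det Q * det (mat x - L) * det P" by (metis det_mul mult.assoc)
  moreover have "det Q * det P = 1" by (metis PQ(2) det_I det_mul)
  ultimately have "det (mat x - L) = det (mat x - M)" by (simp add: mult_ac)
  also have "\<dots> = x ^ (CARD('n) - 2) * ((x - M $ b $ b) * (x - M $ c $ c) - M $ b $ c * M $ c $ b)"
    by (rule det_mat_minus_two_columns) (use assms M0 in auto)
  finally show ?thesis
    unfolding LM LLM trM trMM by (simp add: field_simps power2_eq_square)
qed

section \<open>Characteristic polynomials and multisets of roots\<close>

lemma poly_charpoly: "poly (charpoly A) x = det (mat x - A)"
proof -
  have "poly (mat [:0, 1:] $ i $ j - map_matrix (\<lambda>a. [:a:]) A $ i $ j) x = (mat x - A) $ i $ j" for i j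
    by (simp add: mat_def map_matrix_def)
  thus ?thesis
    by (simp add: charpoly_def det_def poly_sum poly_prod)
qed

lemma proots_prod_linear: "proots (\<Prod>a\<in>#A. [:- a, 1:]) = A" for A :: "'a::idom multiset"
proof (induction A)
  case (add a A)
  have "(\<Prod>a\<in>#A. [:- a, 1:]) \<noteq> 0" by (auto simp: prod_mset_zero_iff)
  thus ?case using add by (simp add: proots_mult del: mult_pCons_left)
qed simp

lemma poly_prod_linear: "poly (\<Prod>a\<in>#A. [:- a, 1:]) x = (\<Prod>a\<in>#A. x - a)"
  for x :: "'a::comm_ring_1"
  by (induction A) (simp_all add: algebra_simps del: mult_pCons_left)

lemma det_map_of_real: "det (map_matrix complex_of_real A) = of_real (det A)"
  by (simp add: det_def map_matrix_def)

text \<open>A complex polynomial that vanishes at all real points is zero. Hence determinant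
  identities obtained by real analysis determine the complex spectrum.\<close>

lemma charpoly_of_real_eqI:
  fixes A :: "real ^ 'n ^ 'n"
  assumes "\<And>x. complex_of_real (det (mat x - A)) = poly q (of_real x)"
  shows "charpoly (map_matrix complex_of_real A) = q"
proof (rule ccontr)
  let ?p = "charpoly (map_matrix complex_of_real A) - q"
  assume "\<not> ?thesis"
  hence "finite {z. poly ?p z = 0}" by (intro poly_roots_finite) simp
  moreover have "of_real x \<in> {z. poly ?p z = 0}" for x
  proof -
    have "mat (of_real x) - map_matrix complex_of_real A = map_matrix complex_of_real (mat x - A)"
      by (simp add: vec_eq_iff map_matrix_def mat_def)
    thus ?thesis using assms[of x] by (simp add: poly_charpoly det_map_of_real)
  qed
  hence "range complex_of_real \<subseteq> {z. poly ?p z = 0}" by blast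
  moreover have "infinite (range complex_of_real)"
    by (simp add: finite_image_iff inj_on_def infinite_UNIV_char_0)
  ultimately show False using finite_subset by blast
qed

section \<open>Determinants of block matrices and the second-order pencil\<close>

definition block_matrix ::
    "'a ^ 'n ^ 'n \<Rightarrow> 'a ^ 'n ^ 'n \<Rightarrow> 'a ^ 'n ^ 'n \<Rightarrow> 'a ^ 'n ^ 'n \<Rightarrow> 'a ^ ('n + 'n) ^ ('n + 'n)" where
  "block_matrix A B C D = (\<chi> r c. case r of
      Inl i \<Rightarrow> (case c of Inl j \<Rightarrow> A $ i $ j | Inr j \<Rightarrow> B $ i $ j)
    | Inr i \<Rightarrow> (case c of Inl j \<Rightarrow> C $ i $ j | Inr j \<Rightarrow> D $ i $ j))"

lemma block_matrix_nth [simp]: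
  "block_matrix A B C D $ Inl i $ Inl j = A $ i $ j"
  "block_matrix A B C D $ Inl i $ Inr j = B $ i $ j"
  "block_matrix A B C D $ Inr i $ Inl j = C $ i $ j"
  "block_matrix A B C D $ Inr i $ Inr j = D $ i $ j"
  by (simp_all add: block_matrix_def)

lemma block_matrix_mult:
  fixes A B C D :: "'a::semiring_1 ^ 'n ^ 'n"
  shows "block_matrix A B C D ** block_matrix A' B' C' D' =
    block_matrix (A ** A' + B ** C') (A ** B' + B ** D') (C ** A' + D ** C') (C ** B' + D ** D')"
proof -
  have "(\<Sum>k\<in>UNIV. f k) = (\<Sum>k\<in>UNIV. f (Inl k)) + (\<Sum>k\<in>UNIV. f (Inr k))" for f :: "'n + 'n \<Rightarrow> 'a"
    unfolding UNIV_sum by (subst sum.union_disjoint) (auto simp: sum.reindex)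
  thus ?thesis
    by (simp add: vec_eq_iff split_sum_all matrix_matrix_mult_def)
qed

text \<open>The zero block forces a permutation with nonzero term to map \<open>Inl\<close> indices
  to \<open>Inl\<close> indices and, by finiteness, \<open>Inr\<close> to \<open>Inr\<close>. Such
  permutations are the direct sums \<open>map_sum p q\<close>, on which sign and product
  factor.\<close>

lemma det_block_matrix_lower:
  fixes A C D :: "'a::comm_ring_1 ^ 'n ^ 'n"
  shows "det (block_matrix A 0 C D) = det A * det D"
proof -
  define B where "B = block_matrix A 0 C D"
  have B: "B $ Inl i $ Inl j = A $ i $ j" "B $ Inl i $ Inr j = 0" "B $ Inr i $ Inr j = D $ i $ j" for i j
    by (simp_all add: B_def)
  let ?S = "\<lambda>(p, q). map_sum p q :: 'n + 'n \<Rightarrow> 'n + 'n"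
  let ?f = "\<lambda>p. of_int (sign p) * (\<Prod>i\<in>UNIV. B $ i $ p i)"
  let ?X = "{p :: 'n \<Rightarrow> 'n. p permutes UNIV}"
  have inj: "inj_on ?S (?X \<times> ?X)"
    by (rule inj_onI) (auto simp: fun_eq_iff split_sum_all)
  have bij: "map_sum p q permutes UNIV" if "p \<in> ?X" "q \<in> ?X" for p q :: "'n \<Rightarrow> 'n"
  proof -
    have "bij p" "bij q" using that by (auto intro: permutes_bij)
    hence "bij (map_sum p q)"
      by (intro o_bij[of "map_sum (inv p) (inv q)"])
        (simp_all add: map_sum.comp map_sum.id bij_is_inj bij_is_surj surj_iff[THEN iffD1])
    thus ?thesis by (intro bij_imp_permutes) auto
  qed
  have sgn: "sign (map_sum p q) = sign p * sign q" if "p \<in> ?X" "q \<in> ?X" for p q :: "'n \<Rightarrow> 'n"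
  proof -
    \<comment> \<open>Each factor is a copy of \<open>p\<close> or \<open>q\<close> under an
      injective relabelling, extended by the identity, and so keeps its sign.\<close>
    have l: "map_permutation UNIV Inl p = (map_sum p id :: 'n + 'n \<Rightarrow> _)"
     and r: "map_permutation UNIV Inr q = (map_sum id q :: 'n + 'n \<Rightarrow> _)"
      by (auto simp: map_permutation_def restrict_id_def fun_eq_iff split_sum_all)
    have "sign (map_sum p id :: 'n + 'n \<Rightarrow> _) = sign p" "sign (map_sum id q :: 'n + 'n \<Rightarrow> _) = sign q"
      unfolding l[symmetric] r[symmetric] using that by (auto intro!: sign_map_permutation)
    moreover have "permutation (map_sum p id :: 'n + 'n \<Rightarrow> _)" "permutation (map_sum id q :: 'n + 'n \<Rightarrow> _)"
      using that by (auto intro!: bij permutes_imp_permutation[of UNIV] simp: permutes_id)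
    moreover have "map_sum p q = map_sum p id \<circ> map_sum id q"
      by (simp add: map_sum.comp)
    ultimately show ?thesis by (simp add: sign_compose)
  qed
  have prod: "(\<Prod>i\<in>UNIV. B $ i $ map_sum p q i) = (\<Prod>i\<in>UNIV. A $ i $ p i) * (\<Prod>i\<in>UNIV. D $ i $ q i)"
    for p q
    unfolding UNIV_sum by (subst prod.union_disjoint) (auto simp: prod.reindex B)
  have zero: "?f r = 0" if r: "r permutes UNIV" "r \<notin> ?S ` (?X \<times> ?X)" for r
  proof (rule ccontr)
    assume nz: "?f r \<noteq> 0"
    have "\<exists>j. r (Inl i) = Inl j" for i
    proof (rule ccontr)
      assume "\<nexists>j. r (Inl i) = Inl j"
      then obtain j where "r (Inl i) = Inr j" by (cases "r (Inl i)") auto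
      hence "B $ Inl i $ r (Inl i) = 0" by (simp add: B)
      hence "(\<Prod>i\<in>UNIV. B $ i $ r i) = 0" by (intro prod_zero) auto
      thus False using nz by simp
    qed
    then obtain p where p: "\<And>i. r (Inl i) = Inl (p i)" by metis
    have "inj r" using r by (auto intro: permutes_inj)
    have "inj p"
      by (rule injI) (metis Inl_inject \<open>inj r\<close> injD p)
    hence "surj p" by (simp add: finite_UNIV_inj_surj)
    \<comment> \<open>By surjectivity of \<open>p\<close> all \<open>Inl\<close> values are already
      taken, so injectivity of \<open>r\<close> leaves only \<open>Inr\<close> values.\<close>
    have "\<exists>j. r (Inr i) = Inr j" for i
    proof (cases "r (Inr i)")
      case (Inl k)
      obtain k' where "k = p k'" using \<open>surj p\<close> by blast
      hence "r (Inl k') = r (Inr i)" using Inl p by simp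
      thus ?thesis using \<open>inj r\<close> by (simp add: inj_eq)
    qed auto
    then obtain q where q: "\<And>i. r (Inr i) = Inr (q i)" by metis
    have "inj q" by (rule injI) (metis Inr_inject \<open>inj r\<close> injD q)
    have "p permutes UNIV" "q permutes UNIV"
      using \<open>inj p\<close> \<open>inj q\<close> by (auto intro!: bij_imp_permutes simp: bij_def finite_UNIV_inj_surj)
    moreover have "r = map_sum p q" by (auto simp: fun_eq_iff split_sum_all p q)
    ultimately show False using r by auto
  qed
  have "det B = sum ?f {r. r permutes UNIV}" by (simp add: det_def)
  also have "\<dots> = sum ?f (?S ` (?X \<times> ?X))"
    by (rule sum.mono_neutral_right) (use zero bij in \<open>auto simp: finite_permutations\<close>)
  also have "\<dots> = (\<Sum>(p, q)\<in>?X \<times> ?X. (of_int (sign p) * (\<Prod>i\<in>UNIV. A $ i $ p i)) *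
      (of_int (sign q) * (\<Prod>i\<in>UNIV. D $ i $ q i)))"
    by (subst sum.reindex[OF inj]) (auto intro!: sum.cong simp: sgn prod mult_ac)
  also have "\<dots> = det A * det D"
    by (simp add: det_def sum_product sum.cartesian_product)
  finally show ?thesis by (simp add: B_def)
qed

lemma det_block_matrix_upper:
  fixes A B D :: "'a::comm_ring_1 ^ 'n ^ 'n"
  shows "det (block_matrix A B 0 D) = det A * det D"
proof -
  have "transpose (block_matrix A B 0 D) =
      block_matrix (transpose A) 0 (transpose B) (transpose D)"
    by (simp add: vec_eq_iff split_sum_all transpose_def)
  hence "det (block_matrix A B 0 D) = det (block_matrix (transpose A) 0 (transpose B) (transpose D))"
    by (metis det_transpose)
  thus ?thesis by (simp add: det_block_matrix_lower)
qed

lemma mat_mult_mat: "mat a ** mat b = mat (a * b)"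
  by (auto simp: vec_eq_iff matrix_matrix_mult_def mat_def if_distrib[of "\<lambda>u. u * _"]
      if_distrib[of "\<lambda>u. _ * u"] cong: if_cong)

text \<open>Block column operations of determinant one suffice, so nothing is divided by.
  \<open>?U\<close> adds \<open>x\<close> times the second block column to the first, which clears
  the upper left block and produces \<open>mat (x * y) - L\<close> below it.\<close>

lemma det_second_order_pencil:
  fixes L :: "'a::comm_ring_1 ^ 'n ^ 'n"
  shows "det (block_matrix (mat x) (mat (- 1)) (- L) (mat y)) = det (mat (x * y) - L)"
proof -
  txt \<open>The product of the last three factors is the block rotation with blocks \<open>0, 1, - 1, 0\<close>.\<close>
  let ?J = "block_matrix (mat x) (mat (- 1)) (- L) (mat y)"
  let ?U = "block_matrix (mat 1) 0 (mat x) (mat 1) :: 'a ^ ('n + 'n) ^ ('n + 'n)"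
  let ?V = "block_matrix (mat 1) (mat 1) 0 (mat 1) :: 'a ^ ('n + 'n) ^ ('n + 'n)"
  let ?W = "block_matrix (mat 1) 0 (mat (- 1)) (mat 1) :: 'a ^ ('n + 'n) ^ ('n + 'n)"
  have mult_zero: "A ** 0 = 0" for A :: "'a ^ 'n ^ 'n"
    by (simp add: vec_eq_iff matrix_matrix_mult_def)
  have mult_minus: "A ** mat (- 1) = - A" for A :: "'a ^ 'n ^ 'n"
    by (simp add: vec_eq_iff matrix_matrix_mult_def mat_def if_distrib[of "\<lambda>u. _ * u"] cong: if_cong)
  have "?J ** ?U ** ?V ** ?W ** ?V = block_matrix (mat 1) 0 (mat (- y)) (mat (x * y) - L)"
    by (simp add: block_matrix_mult mat_mult_mat mult_zero mult_minus)
      (simp add: vec_eq_iff split_sum_all mat_def mult_ac)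
  from arg_cong[OF this, of det] show ?thesis
    by (simp add: det_mul det_block_matrix_lower det_block_matrix_upper)
qed

text \<open>This is the pencil at \<open>y = x + \<gamma>\<close>: each eigenvalue \<lambda> of
  \<open>L\<close> contributes the two roots of
  \<open>x * (x + \<gamma>) = \<lambda>\<close>.\<close>

lemma poly_charpoly_inertia_jacobian:
  "poly (charpoly (map_matrix complex_of_real (inertia_jacobian \<gamma> L))) x =
    poly (charpoly (map_matrix complex_of_real L)) (x * (x + of_real \<gamma>))"
proof -
  have "mat x - map_matrix complex_of_real (inertia_jacobian \<gamma> L) =
      block_matrix (mat x) (mat (- 1)) (- map_matrix complex_of_real L) (mat (x + of_real \<gamma>))"
    by (simp add: vec_eq_iff split_sum_all inertia_jacobian_def mat_def map_matrix_def)
  thus ?thesis by (simp add: poly_charpoly det_second_order_pencil)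
qed

section \<open>Maps that are constant on the splay manifold\<close>

lemma order_parameter_eq_0_iff:
  fixes \<phi> :: "real ^ 'n"
  shows "order_parameter m \<phi> = 0 \<longleftrightarrow>
    (\<Sum>j\<in>UNIV. cos (m * \<phi> $ j)) = 0 \<and> (\<Sum>j\<in>UNIV. sin (m * \<phi> $ j)) = 0"
proof -
  have "exp (\<i> * of_nat m * of_real (\<phi> $ j)) = cis (m * \<phi> $ j)" for j
    by (simp add: cis_conv_exp mult_ac)
  thus ?thesis
    by (simp add: order_parameter_def complex_eq_iff Re_sum Im_sum)
qed

lemma periodic_in_each_argument_of_int:
  assumes "periodic_in_each_argument F"
  shows "F (\<phi> + (2 * pi * of_int k) *\<^sub>R axis j 1) = F \<phi>"
proof (induction k rule: int_induct[where k = 0])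
  case (step1 k)
  have "\<phi> + (2 * pi * of_int (k + 1)) *\<^sub>R axis j 1 =
      (\<phi> + (2 * pi * of_int k) *\<^sub>R axis j 1) + (2 * pi) *\<^sub>R axis j 1"
    by (simp add: algebra_simps)
  thus ?case using assms step1 by (simp only: periodic_in_each_argument_def)
next
  case (step2 k)
  have "\<phi> + (2 * pi * of_int k) *\<^sub>R axis j 1 =
      (\<phi> + (2 * pi * of_int (k - 1)) *\<^sub>R axis j 1) + (2 * pi) *\<^sub>R axis j 1"
    by (simp add: algebra_simps)
  thus ?case using assms step2 by (simp only: periodic_in_each_argument_def)
qed simp

lemma periodic_in_each_argument_sum:
  assumes "periodic_in_each_argument F" "finite S"
  shows "F (\<phi> + (\<Sum>j\<in>S. (2 * pi * of_int (k j)) *\<^sub>R axis j 1)) = F \<phi>"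
  using \<open>finite S\<close>
proof (induction S)
  case (insert j S)
  have "\<phi> + (\<Sum>j\<in>insert j S. (2 * pi * of_int (k j)) *\<^sub>R axis j 1) =
      (\<phi> + (\<Sum>j\<in>S. (2 * pi * of_int (k j)) *\<^sub>R axis j 1)) + (2 * pi * of_int (k j)) *\<^sub>R axis j 1"
    using insert by (simp add: add_ac)
  thus ?case by (simp only: insert.IH periodic_in_each_argument_of_int[OF assms(1)])
qed simp

text \<open>Uniqueness of derivatives makes the velocity constant and the acceleration zero; the
  equation at time 0 then gives the value of \<open>F\<close>.\<close>

lemma splay_state_imp_eq:
  assumes "splay_state m \<gamma> p F \<Omega> \<theta>"
  shows "F \<theta> = (\<gamma> * \<Omega> - p) *\<^sub>R 1"
proof -
  define \<phi> :: "real \<Rightarrow> real ^ 'a" where "\<phi> t = (\<Omega> * t) *\<^sub>R 1 + \<theta>" for t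
  obtain \<phi>' \<phi>'' where *: "\<And>t. (\<phi> has_vector_derivative \<phi>' t) (at t)"
      "\<And>t. (\<phi>' has_vector_derivative \<phi>'' t) (at t)"
      "\<And>t. \<phi>'' t + \<gamma> *\<^sub>R \<phi>' t = p *\<^sub>R 1 + F (\<phi> t)"
    using assms unfolding splay_state_def oscillator_solution_def \<phi>_def[abs_def] by blast
  have "(\<phi> has_vector_derivative \<Omega> *\<^sub>R 1) (at t)" for t
    unfolding \<phi>_def by (auto intro!: derivative_eq_intros)
  hence "\<phi>' t = \<Omega> *\<^sub>R 1" for t
    using *(1) vector_derivative_unique_at by blast
  hence "\<phi>' = (\<lambda>t. \<Omega> *\<^sub>R 1)" by blast
  hence "\<phi>'' 0 = 0"
    using *(2)[of 0] vector_derivative_unique_at[of \<phi>' _ 0 0] by (auto intro: derivative_intros)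
  thus ?thesis
    using *(3)[of 0] \<open>\<phi>' = _\<close> by (simp add: \<phi>_def algebra_simps)
qed

text \<open>The hypothesis concerns phases in the box from 0 to 2 pi only. Periodicity extends it to
  the full zero set, as needed for curves that may leave the box.\<close>

lemma splay_constant:
  fixes F :: "real ^ 'n \<Rightarrow> real ^ 'n"
  assumes per: "periodic_in_each_argument F"
    and splay: "\<forall>\<eta>\<in>splay_manifold m. splay_state m \<gamma> p F \<Omega> \<eta>"
    and zero: "order_parameter m \<phi> = 0"
  shows "F \<phi> = (\<gamma> * \<Omega> - p) *\<^sub>R 1"
proof -
  define k where "k j = \<lfloor>\<phi> $ j / (2 * pi)\<rfloor>" for j
  define \<eta> :: "real ^ 'n" where "\<eta> = (\<chi> j. \<phi> $ j - 2 * pi * of_int (k j))"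
  have range: "0 \<le> \<eta> $ j \<and> \<eta> $ j < 2 * pi" for j
  proof -
    have "of_int (k j) \<le> \<phi> $ j / (2 * pi)" "\<phi> $ j / (2 * pi) < of_int (k j) + 1"
      unfolding k_def by linarith+
    thus ?thesis by (simp add: \<eta>_def field_simps)
  qed
  \<comment> \<open>Since \<open>m\<close> is an integer, the shift remains a multiple of 2 pi after
    multiplication by \<open>m\<close>.\<close>
  have "m * \<eta> $ j = m * \<phi> $ j - 2 * pi * of_int (int m * k j)" for j
    by (simp add: \<eta>_def algebra_simps)
  hence "cos (m * \<eta> $ j) = cos (m * \<phi> $ j)" "sin (m * \<eta> $ j) = sin (m * \<phi> $ j)" for j
    using sin_int_2pin[of "int m * k j"] cos_int_2pin[of "int m * k j"]
    by (simp_all add: cos_diff sin_diff)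
  hence "order_parameter m \<eta> = 0" using zero by (simp add: order_parameter_eq_0_iff)
  with range have "\<eta> \<in> splay_manifold m" by (simp add: splay_manifold_def)
  hence "F \<eta> = (\<gamma> * \<Omega> - p) *\<^sub>R 1" using splay splay_state_imp_eq by blast
  moreover have "\<phi> = \<eta> + (\<Sum>j\<in>UNIV. (2 * pi * of_int (k j)) *\<^sub>R axis j 1)"
    by (simp add: vec_eq_iff \<eta>_def axis_def if_distrib[of "\<lambda>u. _ * u"] cong: if_cong)
  ultimately show ?thesis
    using periodic_in_each_argument_sum[OF per, of UNIV \<eta> k] by simp
qed

text \<open>Differentiating along the all-ones direction gives \<open>F' 1 = 0\<close>, so the rows
  of the Jacobian sum to zero. The diagonal prescribed in \<open>splay_L\<close> is therefore the
  true one.\<close>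

lemma splay_L_eq_matrix:
  fixes F :: "real ^ 'n \<Rightarrow> real ^ 'n"
  assumes F': "(F has_derivative F') (at \<theta>)" and inv: "phase_shift_invariant F"
  shows "splay_L F \<theta> = matrix F'"
proof -
  interpret F': bounded_linear F' using F' by (rule has_derivative_bounded_linear)
  have pd: "partial_deriv F i j \<theta> = F' (axis j 1) $ i" for i j
  proof -
    have eq: "(\<chi> k. if k = j then x else \<theta> $ k) = \<theta> + (x - \<theta> $ j) *\<^sub>R axis j 1" for x
      by (simp add: vec_eq_iff axis_def)
    have "((\<lambda>x. \<theta> + (x - \<theta> $ j) *\<^sub>R axis j 1) has_derivative (\<lambda>h. h *\<^sub>R axis j 1)) (at (\<theta> $ j))"
      by (auto intro!: derivative_eq_intros)
    from has_derivative_compose[OF this, of F F'] F'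
    have "((\<lambda>x. F (\<theta> + (x - \<theta> $ j) *\<^sub>R axis j 1)) has_derivative (\<lambda>h. h *\<^sub>R F' (axis j 1))) (at (\<theta> $ j))"
      by (simp add: F'.scaleR)
    from bounded_linear.has_derivative[OF bounded_linear_vec_nth this, of i]
    have "((\<lambda>x. F (\<theta> + (x - \<theta> $ j) *\<^sub>R axis j 1) $ i) has_field_derivative F' (axis j 1) $ i) (at (\<theta> $ j))"
      by (simp add: has_field_derivative_def mult_commute_abs)
    thus ?thesis unfolding partial_deriv_def eq by (rule DERIV_imp_deriv)
  qed
  have "((\<lambda>t. \<theta> + t *\<^sub>R 1) has_derivative (\<lambda>h. h *\<^sub>R 1)) (at 0)"
    by (auto intro!: derivative_eq_intros)
  from has_derivative_compose[OF this, of F F'] F'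
  have "((\<lambda>t. F (\<theta> + t *\<^sub>R 1)) has_derivative (\<lambda>h. F' (h *\<^sub>R 1))) (at 0)" by simp
  moreover have "((\<lambda>t. F (\<theta> + t *\<^sub>R 1)) has_derivative (\<lambda>h. 0)) (at (0::real))"
    using inv by (simp add: phase_shift_invariant_def)
  ultimately have "(\<lambda>h. F' (h *\<^sub>R 1)) = (\<lambda>h. 0)" by (rule has_derivative_unique)
  from fun_cong[OF this, of 1] have "F' 1 = 0" by simp
  moreover have "(1 :: real ^ 'n) = (\<Sum>k\<in>UNIV. axis k 1)"
    by (simp add: vec_eq_iff axis_def)
  ultimately have "(\<Sum>k\<in>UNIV. F' (axis k 1)) = 0" by (simp add: F'.sum[symmetric])
  hence row: "(\<Sum>k\<in>UNIV. F' (axis k 1) $ i) = 0" for i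
    by (simp add: sum_component[symmetric])
  have "- (\<Sum>k\<in>UNIV - {i}. F' (axis k 1) $ i) = F' (axis i 1) $ i" for i
    using row[of i] by (simp add: sum_diff1)
  thus ?thesis by (simp add: vec_eq_iff splay_L_def pd matrix_def)
qed

text \<open>\<open>H\<close> serves as a local chart, and \<open>P\<close> is the matrix of the
  inverse of \<open>H' \<theta>\<close>: its columns outside \<open>K\<close> are tangent to the
  level set of the coordinates in \<open>K\<close>, hence are killed by \<open>F'\<close>.\<close>

lemma constant_on_level_set_kernel:
  fixes F H :: "real ^ 'n \<Rightarrow> real ^ 'n" and H' :: "real ^ 'n \<Rightarrow> ((real ^ 'n) \<Rightarrow>\<^sub>L (real ^ 'n))"
  assumes H': "\<And>x. (H has_derivative H' x) (at x)" "continuous_on UNIV H'" "inj (H' \<theta>)"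
    and F': "(F has_derivative F') (at \<theta>)"
    and const: "\<And>x. (\<And>k. k \<in> K \<Longrightarrow> H x $ k = H \<theta> $ k) \<Longrightarrow> F x = F \<theta>"
  obtains P where "invertible P" "\<And>i j. j \<notin> K \<Longrightarrow> (matrix F' ** P) $ i $ j = 0"
proof -
  have lin: "linear (H' \<theta>)" by (simp add: blinfun.bounded_linear_right bounded_linear.linear)
  have "bij (H' \<theta>)" using lin \<open>inj _\<close> by (simp add: bij_def linear_injective_imp_surjective)
  define G where "G = inv (blinfun_apply (H' \<theta>))"
  have G: "G (H' \<theta> v) = v" "H' \<theta> (G v) = v" for v
    using \<open>bij _\<close> by (simp_all add: G_def bij_is_inj bij_is_surj surj_f_inv_f)
  have "linear G" unfolding G_def using lin \<open>bij _\<close>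
    by (metis bij_is_inj bij_is_surj inj_linear_imp_inv_linear)
  hence inv: "Blinfun G o\<^sub>L H' \<theta> = id_blinfun"
    by (intro blinfun_eqI) (simp add: bounded_linear_Blinfun_apply linear_conv_bounded_linear[symmetric] G)
  obtain U V g g' where g: "open V" "H \<theta> \<in> V" "\<theta> \<in> U" "homeomorphism U V H g"
      "\<And>y. y \<in> V \<Longrightarrow> (g has_derivative (g' y)) (at y)"
      "\<And>y. y \<in> V \<Longrightarrow> g' y = inv (blinfun_apply (H' (g y)))"
    by (rule inverse_function_theorem[OF open_UNIV H'(1) H'(2) UNIV_I inv]) blast
  have g\<theta>: "g (H \<theta>) = \<theta>" using g by (simp add: homeomorphism_def)
  txt \<open>Along the preimage under \<open>H\<close> of a line in a coordinate direction outside \<open>K\<close>, \<open>F\<close> is constant.\<close>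
  have gG: "(g has_derivative G) (at (H \<theta>))"
    using g(5,6)[OF g(2)] by (simp add: G_def g\<theta>)
  have ker: "F' (G (axis j 1)) = 0" if "j \<notin> K" for j
  proof -
    let ?y = "\<lambda>t. H \<theta> + t *\<^sub>R axis j 1"
    have y: "(?y has_derivative (\<lambda>h. h *\<^sub>R axis j 1)) (at 0)"
      by (auto intro!: derivative_eq_intros)
    have "((\<lambda>t. g (?y t)) has_derivative (\<lambda>h. G (h *\<^sub>R axis j 1))) (at 0)"
      using has_derivative_compose[OF y, of g G] gG by simp
    hence 1: "((\<lambda>t. F (g (?y t))) has_derivative (\<lambda>h. F' (G (h *\<^sub>R axis j 1)))) (at 0)"
      using has_derivative_compose[of "\<lambda>t. g (?y t)" _ 0 UNIV F F'] F' g\<theta> by simp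
    have "open (?y -` V)" by (intro continuous_open_vimage continuous_intros \<open>open V\<close>)
    moreover have "0 \<in> ?y -` V" using g(2) by simp
    moreover have "F \<theta> = F (g (?y t))" if "t \<in> ?y -` V" for t
    proof -
      have "H (g (?y t)) = ?y t" using g(4) that by (simp add: homeomorphism_def)
      thus ?thesis using \<open>j \<notin> K\<close> by (intro const[symmetric]) (auto simp: axis_def)
    qed
    ultimately have "((\<lambda>t. F (g (?y t))) has_derivative (\<lambda>h. 0)) (at 0)"
      by (rule has_derivative_transform_within_open[OF has_derivative_const])
    with 1 have "(\<lambda>h. F' (G (h *\<^sub>R axis j 1))) = (\<lambda>h. 0)" by (rule has_derivative_unique)
    from fun_cong[OF this, of 1] show ?thesis by simp
  qed
  have "linear F'" using F' by (simp add: has_derivative_linear)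
  have "matrix (H' \<theta>) ** matrix G = mat 1" "matrix G ** matrix (H' \<theta>) = mat 1"
    using lin \<open>linear G\<close> by (simp_all add: matrix_compose[symmetric] o_def G matrix_id_mat_1[unfolded id_def])
  hence "invertible (matrix G)" unfolding invertible_def by blast
  moreover have "(matrix F' ** matrix G) $ i $ j = 0" if "j \<notin> K" for i j
    using ker[OF that] \<open>linear F'\<close> \<open>linear G\<close>
    by (simp add: matrix_compose[symmetric]) (simp add: matrix_def)
  ultimately show thesis by (rule that)
qed

section \<open>The spectrum at a splay state\<close>

text \<open>The derivative of the chart \<open>H\<close> at \<theta> has determinant
  \<open>- m\<^sup>2 * sin (m * (\<theta> $ b - \<theta> $ c))\<close>, so regularity is exactly
  what makes it invertible.\<close>

lemma regular_splay_kernel: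
  fixes F :: "real ^ 'n \<Rightarrow> real ^ 'n" and m :: nat
  assumes F': "(F has_derivative F') (at \<theta>)"
    and const: "\<And>\<phi>. order_parameter m \<phi> = 0 \<Longrightarrow> F \<phi> = F \<theta>"
    and zero: "order_parameter m \<theta> = 0"
    and regular: "sin (m * (\<theta> $ b - \<theta> $ c)) \<noteq> 0"
  obtains P where "invertible P" "\<And>i j. j \<notin> {b, c} \<Longrightarrow> (matrix F' ** P) $ i $ j = 0"
proof -
  have "b \<noteq> c" "m \<noteq> 0" using regular by (force, intro notI, simp)
  define H :: "real ^ 'n \<Rightarrow> real ^ 'n" where
    "H \<phi> = (\<chi> k. if k = b then \<Sum>j\<in>UNIV. cos (m * \<phi> $ j)
                 else if k = c then \<Sum>j\<in>UNIV. sin (m * \<phi> $ j) else \<phi> $ k)" for \<phi>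
  define D :: "real ^ 'n \<Rightarrow> real ^ 'n \<Rightarrow> real ^ 'n" where
    "D \<phi> v = (\<chi> k. if k = b then \<Sum>j\<in>UNIV. - sin (m * \<phi> $ j) * (m * v $ j)
                 else if k = c then \<Sum>j\<in>UNIV. cos (m * \<phi> $ j) * (m * v $ j) else v $ k)" for \<phi> v
  have HD: "(H has_derivative D \<phi>) (at \<phi>)" for \<phi>
  proof -
    have "((\<lambda>\<phi>. if k = b then \<Sum>j\<in>UNIV. cos (m * \<phi> $ j)
                 else if k = c then \<Sum>j\<in>UNIV. sin (m * \<phi> $ j) else \<phi> $ k) has_derivative
           (\<lambda>v. if k = b then \<Sum>j\<in>UNIV. - sin (m * \<phi> $ j) * (m * v $ j)
                 else if k = c then \<Sum>j\<in>UNIV. cos (m * \<phi> $ j) * (m * v $ j) else v $ k)) (at \<phi>)"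
      for k :: 'n
      by (cases "k = b"; cases "k = c")
        (auto intro!: derivative_eq_intros bounded_linear.has_derivative[OF bounded_linear_vec_nth]
          sum.cong simp: fun_eq_iff sum_negf mult_ac)
    thus ?thesis unfolding H_def D_def 
      by (subst has_derivative_componentwise_within) (auto simp: Basis_vec_def inner_axis)
  qed
  hence bl: "bounded_linear (D \<phi>)" for \<phi> by (rule has_derivative_bounded_linear)
  define H' where "H' \<phi> = Blinfun (D \<phi>)" for \<phi>
  have H': "blinfun_apply (H' \<phi>) = D \<phi>" for \<phi>
    by (simp add: H'_def bounded_linear_Blinfun_apply bl)
  have "continuous_on UNIV (\<lambda>\<phi>. D \<phi> v)" for v
  proof -
    have "continuous_on UNIV (\<lambda>\<phi> :: real ^ 'n. if k = b then \<Sum>j\<in>UNIV. - sin (m * \<phi> $ j) * (m * v $ j)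
                 else if k = c then \<Sum>j\<in>UNIV. cos (m * \<phi> $ j) * (m * v $ j) else v $ k)" for k
      by (cases "k = b"; cases "k = c") (auto intro!: continuous_intros)
    thus ?thesis unfolding D_def by (rule continuous_on_vec_lambda)
  qed
  \<comment> \<open>In finite dimension, continuity at each fixed vector gives continuity in the
    operator norm.\<close>
  hence cont: "continuous_on UNIV H'"
    by (intro continuous_on_blinfun_componentwise) (simp add: H')
  have inj: "inj (D \<theta>)"
  proof -
    have "v = 0" if "D \<theta> v = 0" for v
    proof -
      have D0: "D \<theta> v $ k = 0" for k using that by simp
      have v0: "v $ k = 0" if "k \<notin> {b, c}" for k
        using D0[of k] that by (simp add: D_def)
      have two: "(\<Sum>j\<in>UNIV. f j * (m * v $ j)) = m * (f b * v $ b + f c * v $ c)" for f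
      proof -
        have "(\<Sum>j\<in>UNIV. f j * (m * v $ j)) = (\<Sum>j\<in>{b, c}. f j * (m * v $ j))"
          by (rule sum.mono_neutral_right) (auto simp: v0)
        thus ?thesis using \<open>b \<noteq> c\<close> by (simp add: algebra_simps)
      qed
      have s: "sin (m * \<theta> $ b) * v $ b + sin (m * \<theta> $ c) * v $ c = 0"
        using D0[of b] two[of "\<lambda>j. - sin (m * \<theta> $ j)"] \<open>m \<noteq> 0\<close> by (simp add: D_def)
      have c: "cos (m * \<theta> $ b) * v $ b + cos (m * \<theta> $ c) * v $ c = 0"
        using D0[of c] two[of "\<lambda>j. cos (m * \<theta> $ j)"] \<open>m \<noteq> 0\<close> \<open>b \<noteq> c\<close> by (simp add: D_def)
      have sd: "sin (m * (\<theta> $ b - \<theta> $ c)) =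
          sin (m * \<theta> $ b) * cos (m * \<theta> $ c) - cos (m * \<theta> $ b) * sin (m * \<theta> $ c)"
        by (simp add: right_diff_distrib sin_diff)
      \<comment> \<open>Cramer's rule for the 2 by 2 system formed by \<open>s\<close> and
        \<open>c\<close>.\<close>
      have "sin (m * (\<theta> $ b - \<theta> $ c)) * v $ b = 0" "sin (m * (\<theta> $ b - \<theta> $ c)) * v $ c = 0"
        unfolding sd using s c by algebra+
      hence "v $ b = 0" "v $ c = 0" using regular by auto
      hence "v $ k = 0" for k using v0 by (cases "k \<in> {b, c}") auto
      thus "v = 0" by (simp add: vec_eq_iff)
    qed
    thus ?thesis using bl[of \<theta>] by (simp add: linear_injective_0 bounded_linear.linear)
  qed
  have const': "F \<phi> = F \<theta>" if "\<And>k. k \<in> {b, c} \<Longrightarrow> H \<phi> $ k = H \<theta> $ k" for \<phi>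
  proof (rule const)
    show "order_parameter m \<phi> = 0"
      using that[of b] that[of c] zero \<open>b \<noteq> c\<close> by (simp add: H_def order_parameter_eq_0_iff)
  qed
  show thesis
  proof (rule constant_on_level_set_kernel)
    show "(H has_derivative H' \<phi>) (at \<phi>)" for \<phi> by (simp add: H' HD)
    show "continuous_on UNIV H'" by (fact cont)
    show "inj (H' \<theta>)" by (simp add: H' inj)
    show "(F has_derivative F') (at \<theta>)" by (fact F')
    show "F \<phi> = F \<theta>" if "\<And>k. k \<in> {b, c} \<Longrightarrow> H \<phi> $ k = H \<theta> $ k" for \<phi>
      using that by (rule const')
  qed (rule that)
qed

text \<open>At a singular point all phasors lie on one line through the origin. As they sum to zero,
  some \<open>b\<close> is antipodal to \<open>a\<close>; turning both by the same angle keeps their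
  sum zero, while a third phasor \<open>c\<close> stays put.\<close>

lemma singular_splay_perturbation:
  fixes \<theta> :: "real ^ 'n" and m :: nat
  assumes zero: "order_parameter m \<theta> = 0" and card: "CARD('n) \<ge> 3"
    and singular: "\<And>b c. sin (m * (\<theta> $ b - \<theta> $ c)) = 0"
  obtains v a c where "\<And>t. order_parameter m (\<theta> + t *\<^sub>R v) = 0"
    "\<And>t. sin (real m * t) \<noteq> 0 \<Longrightarrow> sin (m * ((\<theta> + t *\<^sub>R v) $ a - (\<theta> + t *\<^sub>R v) $ c)) \<noteq> 0"
proof -
  obtain a :: 'n where True by blast
  have sums: "(\<Sum>j\<in>UNIV. cos (m * \<theta> $ j)) = 0" "(\<Sum>j\<in>UNIV. sin (m * \<theta> $ j)) = 0"
    using zero by (simp_all add: order_parameter_eq_0_iff)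
  have sin0: "sin (m * \<theta> $ j - m * \<theta> $ k) = 0" for j k
    using singular[of j k] by (simp add: right_diff_distrib)
  have pm: "cos (m * \<theta> $ a - m * \<theta> $ j) = 1 \<or> cos (m * \<theta> $ a - m * \<theta> $ j) = - 1" for j
    using sin_zero_abs_cos_one[OF sin0[of a j]] by linarith
  \<comment> \<open>Projection of the zero sum onto the phasor of \<open>a\<close>: every term is 1
    or -1, and they cannot all be 1.\<close>
  have "(\<Sum>j\<in>UNIV. cos (m * \<theta> $ a - m * \<theta> $ j)) = 0"
    using sums by (simp add: cos_diff sum.distrib sum_distrib_left[symmetric])
  hence "\<exists>b. cos (m * \<theta> $ a - m * \<theta> $ b) = - 1"
    using pm by (metis (no_types, lifting) card_UNIV_def of_nat_eq_0_iff real_of_card sum.cong zero_less_card_finite less_irrefl)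
  then obtain b where b: "cos (m * \<theta> $ a - m * \<theta> $ b) = - 1" by blast
  hence "a \<noteq> b" by auto
  have "m * \<theta> $ b = m * \<theta> $ a - (m * \<theta> $ a - m * \<theta> $ b)" by simp
  hence opp: "cos (m * \<theta> $ b) = - cos (m * \<theta> $ a)" "sin (m * \<theta> $ b) = - sin (m * \<theta> $ a)"
    by (metis b sin0 cos_diff sin_diff mult_zero_right mult_minus1_right add.right_neutral diff_zero)+
  have "card {a, b} < CARD('n)" using card \<open>a \<noteq> b\<close> by simp
  \<comment> \<open>The third oscillator must not belong to the pair, whose own phase difference
    does not change under the rotation.\<close>
  then obtain c where c: "c \<notin> {a, b}" by (metis UNIV_eq_I less_irrefl)
  define v :: "real ^ 'n" where "v = axis a 1 + axis b 1"
  have v: "v $ j = (if j \<in> {a, b} then 1 else 0)" for j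
    using \<open>a \<noteq> b\<close> by (auto simp: v_def axis_def)
  have split: "(\<Sum>j\<in>UNIV. f j) = (\<Sum>j\<in>UNIV - {a, b}. f j) + (f a + f b)" for f :: "'n \<Rightarrow> real"
    using sum.subset_diff[of "{a, b}" UNIV f] \<open>a \<noteq> b\<close> by simp
  have "order_parameter m (\<theta> + t *\<^sub>R v) = 0" for t
    using sums unfolding order_parameter_eq_0_iff split
    by (simp add: v opp distrib_left cos_add sin_add)
  moreover have "sin (m * ((\<theta> + t *\<^sub>R v) $ a - (\<theta> + t *\<^sub>R v) $ c)) \<noteq> 0" if "sin (real m * t) \<noteq> 0" for t
  proof -
    have "m * ((\<theta> + t *\<^sub>R v) $ a - (\<theta> + t *\<^sub>R v) $ c) = (m * \<theta> $ a - m * \<theta> $ c) + real m * t"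
      using c by (simp add: v algebra_simps)
    hence "sin (m * ((\<theta> + t *\<^sub>R v) $ a - (\<theta> + t *\<^sub>R v) $ c)) =
        cos (m * \<theta> $ a - m * \<theta> $ c) * sin (real m * t)"
      by (simp add: sin_add sin0)
    thus ?thesis using pm[of c] that by auto
  qed
  ultimately show thesis by (rule that)
qed

lemma det_mat_minus_splay_L:
  fixes F :: "real ^ 'n \<Rightarrow> real ^ 'n" and m :: nat
  assumes card: "CARD('n) \<ge> 2" and "m \<ge> 1"
    and C1: "continuously_differentiable F"
    and per: "periodic_in_each_argument F"
    and inv: "phase_shift_invariant F"
    and splay: "\<forall>\<eta>\<in>splay_manifold m. splay_state m \<gamma> p F \<Omega> \<eta>"
    and zero: "order_parameter m \<theta> = 0"
  shows "det (mat x - splay_L F \<theta>) = x ^ (CARD('n) - 2) *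
    (x\<^sup>2 - trace (splay_L F \<theta>) * x + ((trace (splay_L F \<theta>))\<^sup>2 - trace (splay_L F \<theta> ** splay_L F \<theta>)) / 2)"
    (is "_ = ?r (splay_L F \<theta>)")
proof -
  obtain F' where F': "\<And>x. (F has_derivative blinfun_apply (F' x)) (at x)" "continuous_on UNIV F'"
    using C1 unfolding continuously_differentiable_def by blast
  have L: "splay_L F \<phi> = matrix (F' \<phi>)" for \<phi>
    using F'(1) inv by (rule splay_L_eq_matrix)
  have regular: "det (mat x - splay_L F \<phi>) = ?r (splay_L F \<phi>)"
    if reg: "order_parameter m \<phi> = 0" "sin (m * (\<phi> $ b - \<phi> $ c)) \<noteq> 0" for \<phi> b c
  proof -
    have const: "F \<eta> = F \<phi>" if "order_parameter m \<eta> = 0" for \<eta>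
      using splay_constant[OF per splay] that \<open>order_parameter m \<phi> = 0\<close> by simp
    obtain P where "invertible P" "\<And>i j. j \<notin> {b, c} \<Longrightarrow> (matrix (F' \<phi>) ** P) $ i $ j = 0"
      using regular_splay_kernel[OF F'(1) const reg] by blast
    moreover have "b \<noteq> c" using reg(2) by auto
    ultimately show ?thesis unfolding L by (intro det_mat_minus_rank_two)
  qed
  \<comment> \<open>For two oscillators every zero of the order parameter is singular and no third
    phasor exists, so this case stands apart.\<close>
  consider "CARD('n) = 2" | b c where "sin (m * (\<theta> $ b - \<theta> $ c)) \<noteq> 0"
    | "CARD('n) \<ge> 3" "\<And>b c. sin (m * (\<theta> $ b - \<theta> $ c)) = 0"
    using card by fastforce
  thus ?thesis
  proof cases
    case 1
    then obtain b c :: 'n where bc: "UNIV = {b, c}" "b \<noteq> c" by (auto simp: card_2_iff)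
    show ?thesis
      \<comment> \<open>With \<open>{b, c}\<close> the whole index set, the condition on zero
        columns is vacuous and the identity matrix serves as \<open>P\<close>.\<close>
      by (rule det_mat_minus_rank_two[of b c "mat 1"]) (use bc in \<open>auto simp: invertible_def intro: exI[of _ "mat 1"]\<close>)
  next
    case 2
    thus ?thesis using regular zero by blast
  next
    case 3
    then obtain v a c where v: "\<And>t. order_parameter m (\<theta> + t *\<^sub>R v) = 0"
      "\<And>t. sin (real m * t) \<noteq> 0 \<Longrightarrow> sin (m * ((\<theta> + t *\<^sub>R v) $ a - (\<theta> + t *\<^sub>R v) $ c)) \<noteq> 0"
      using singular_splay_perturbation[OF zero] by metis
    define M where "M t = splay_L F (\<theta> + t *\<^sub>R v)" for t
    \<comment> \<open>The defect of the identity is a polynomial in the entries of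
      \<open>M t\<close>, so continuity of the derivative of \<open>F\<close> carries its vanishing
      for small positive \<open>t\<close> over to \<open>t = 0\<close>.\<close>
    define e where "e t = det (mat x - M t) - ?r (M t)" for t
    have "continuous_on UNIV (\<lambda>t. F' (\<theta> + t *\<^sub>R v))"
      by (rule continuous_on_compose2[OF F'(2)]) (auto intro!: continuous_intros)
    hence cont: "continuous_on UNIV (\<lambda>t. M t $ i $ j)" for i j
      unfolding M_def L by (auto simp: matrix_def intro!: continuous_intros)
    have "continuous_on UNIV e"
      unfolding e_def det_def trace_def matrix_matrix_mult_def
      by (auto intro!: continuous_intros cont)
    hence "(e \<longlongrightarrow> e 0) (at_right 0)"
      by (auto simp: continuous_on_def intro: tendsto_within_subset)
    moreover have "eventually (\<lambda>t. e t = 0) (at_right 0)"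
    proof -
      \<comment> \<open>The bound keeps \<open>m * t\<close> strictly between 0 and pi, where the
        sine is positive.\<close>
      have "e t = 0" if "0 < t" "t < pi / m" for t :: real
      proof -
        have "0 < sin (real m * t)" using that \<open>m \<ge> 1\<close> by (intro sin_gt_zero) (auto simp: field_simps)
        thus ?thesis using regular[OF v(1) v(2), of t] by (simp add: e_def M_def)
      qed
      moreover have "0 < pi / m" using \<open>m \<ge> 1\<close> by simp
      ultimately show ?thesis unfolding eventually_at_right_field by blast
    qed
    hence "(e \<longlongrightarrow> 0) (at_right 0)" by (rule tendsto_eventually)
    ultimately have "e 0 = 0" by (rule tendsto_unique[rotated]) simp
    thus ?thesis by (simp add: e_def M_def)
  qed
qed

theorem proposition8:
  fixes F :: "real ^ 'n \<Rightarrow> real ^ 'n"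
    and m :: nat
    and p \<gamma> \<Omega> :: real
    and \<theta> :: "real ^ 'n"
    and s r\<^sub>1 r\<^sub>2 lam\<^sub>1 lam\<^sub>2 :: complex
  assumes "CARD('n) \<ge> 2"
    and "m \<ge> 1"
    and "\<gamma> > 0"
    and "continuously_differentiable F"
    and "periodic_in_each_argument F"
    and "phase_shift_invariant F"
    and "\<forall>\<eta>\<in>splay_manifold m. splay_state m \<gamma> p F \<Omega> \<eta>"
    and "\<theta> \<in> splay_manifold m"
    and "s\<^sup>2 = of_real (2 * trace (splay_L F \<theta> ** splay_L F \<theta>) - (trace (splay_L F \<theta>))\<^sup>2)"
    and "lam\<^sub>1 = of_real (trace (splay_L F \<theta>)) / 2 + s / 2"
    and "lam\<^sub>2 = of_real (trace (splay_L F \<theta>)) / 2 - s / 2"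
    and "r\<^sub>1\<^sup>2 = (of_real \<gamma> / 2)\<^sup>2 + lam\<^sub>1"
    and "r\<^sub>2\<^sup>2 = (of_real \<gamma> / 2)\<^sup>2 + lam\<^sub>2"
  shows "(linearly_stable \<gamma> F \<theta> \<longleftrightarrow>
            (\<forall>\<mu>\<in>{- of_real \<gamma> / 2 + r\<^sub>1, - of_real \<gamma> / 2 - r\<^sub>1,
                  - of_real \<gamma> / 2 + r\<^sub>2, - of_real \<gamma> / 2 - r\<^sub>2}. Re \<mu> < 0))
         \<and> eigenvalues (splay_L F \<theta>) = replicate_mset (CARD('n) - 2) 0 + {#lam\<^sub>1, lam\<^sub>2#}"
proof -
  let ?L = "splay_L F \<theta>"
  let ?n = "CARD('n) - 2"
  define \<tau> where "\<tau> = complex_of_real (trace ?L)"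
  define \<mu>s where "\<mu>s = {#- of_real \<gamma> / 2 + r\<^sub>1, - of_real \<gamma> / 2 - r\<^sub>1,
                  - of_real \<gamma> / 2 + r\<^sub>2, - of_real \<gamma> / 2 - r\<^sub>2#}"
  define q where "q = (\<Prod>\<mu>\<in>#replicate_mset ?n 0 + {#lam\<^sub>1, lam\<^sub>2#}. [:- \<mu>, 1:])"
  \<comment> \<open>Only the square of \<open>s\<close> enters the sum and product of the two roots,
    so either square root will do; the same holds for \<open>r\<^sub>1\<close> and
    \<open>r\<^sub>2\<close> in \<open>quad\<close>.\<close>
  have lam: "(x - lam\<^sub>1) * (x - lam\<^sub>2) = x\<^sup>2 - \<tau> * x + (\<tau>\<^sup>2 - of_real (trace (?L ** ?L))) / 2" for x
  proof -
    have "(x - lam\<^sub>1) * (x - lam\<^sub>2) = x\<^sup>2 - \<tau> * x + (\<tau>\<^sup>2 - s\<^sup>2) / 4"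
      unfolding assms(10,11) \<tau>_def by (simp add: field_simps power2_eq_square)
    moreover have "(\<tau>\<^sup>2 - s\<^sup>2) / 4 = (\<tau>\<^sup>2 - of_real (trace (?L ** ?L))) / 2"
      unfolding assms(9) \<tau>_def by simp
    ultimately show ?thesis by simp
  qed
  have chL: "charpoly (map_matrix complex_of_real ?L) = q"
  proof (rule charpoly_of_real_eqI)
    fix x
    have "det (mat x - ?L) = x ^ ?n * (x\<^sup>2 - trace ?L * x + ((trace ?L)\<^sup>2 - trace (?L ** ?L)) / 2)"
      using assms by (intro det_mat_minus_splay_L[of m F \<gamma> p \<Omega>]) (auto simp: splay_manifold_def)
    moreover have "poly q (of_real x) = of_real x ^ ?n * ((of_real x - lam\<^sub>1) * (of_real x - lam\<^sub>2))"
      unfolding q_def poly_prod_linear by simp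
    ultimately show "complex_of_real (det (mat x - ?L)) = poly q (of_real x)"
      by (simp add: lam \<tau>_def)
  qed
  have eigL: "eigenvalues ?L = replicate_mset ?n 0 + {#lam\<^sub>1, lam\<^sub>2#}"
    unfolding eigenvalues_def chL q_def by (rule proots_prod_linear)
  have quad: "x * (x + of_real \<gamma>) - lam = (x - (- of_real \<gamma> / 2 + r)) * (x - (- of_real \<gamma> / 2 - r))"
    if "r\<^sup>2 = (of_real \<gamma> / 2)\<^sup>2 + lam" for x lam r :: complex
  proof -
    have "(x - (- of_real \<gamma> / 2 + r)) * (x - (- of_real \<gamma> / 2 - r)) = (x + of_real \<gamma> / 2)\<^sup>2 - r\<^sup>2"
      by (simp add: algebra_simps power2_eq_square)
    thus ?thesis unfolding that by (simp add: algebra_simps power2_eq_square)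
  qed
  \<comment> \<open>Each of the N - 2 zeros in the spectrum of \<open>L\<close> yields the roots 0
    and \<open>- \<gamma>\<close>. The zeros are split off, and \<open>M\<close> collects the
    remaining (N - 2) + 4 = N + 2 eigenvalues.\<close>
  define M where "M = replicate_mset ?n (- of_real \<gamma>) + \<mu>s"
  define w where "w = (\<Prod>\<mu>\<in>#replicate_mset ?n 0 + M. [:- \<mu>, 1:])"
  have "charpoly (map_matrix complex_of_real (inertia_jacobian \<gamma> ?L)) = w"
  proof (rule poly_eq_poly_eq_iff[THEN iffD1], rule ext)
    fix x
    have "poly (charpoly (map_matrix complex_of_real (inertia_jacobian \<gamma> ?L))) x =
        (x * (x + of_real \<gamma>)) ^ ?n * ((x * (x + of_real \<gamma>) - lam\<^sub>1) * (x * (x + of_real \<gamma>) - lam\<^sub>2))"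
      unfolding poly_charpoly_inertia_jacobian chL q_def poly_prod_linear by simp
    also have "\<dots> = poly w x"
      unfolding quad[OF assms(12)] quad[OF assms(13)] w_def poly_prod_linear M_def \<mu>s_def
      by (simp add: power_mult_distrib mult.assoc)
    finally show "poly (charpoly (map_matrix complex_of_real (inertia_jacobian \<gamma> ?L))) x = poly w x" .
  qed
  hence "eigenvalues (inertia_jacobian \<gamma> ?L) = replicate_mset ?n 0 + M"
    by (simp only: eigenvalues_def w_def proots_prod_linear)
  \<comment> \<open>Cancelling the common zeros shows that \<open>M\<close> is the only possible
    witness for the existential quantifier.\<close>
  hence "linearly_stable \<gamma> F \<theta> \<longleftrightarrow> (\<forall>\<mu>\<in>#M. Re \<mu> < 0)"
    unfolding linearly_stable_def by (metis add_left_cancel)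
  also have "\<dots> \<longleftrightarrow> (\<forall>\<mu>\<in>#\<mu>s. Re \<mu> < 0)"
    using \<open>\<gamma> > 0\<close> by (auto simp: M_def in_replicate_mset)
  finally show ?thesis using eigL by (simp add: \<mu>s_def)
qed

end
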